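(* Assume that the discount function $h(t)$ satisfies $$e^{-\rho_2t}\le h(t)\le e^{-\rho_1t}\qquad\text{for }t\ge0$$ for some $0<\rho_1\le\rho_2$, and that $\bar k$ is an equilibrium point for $h$. Then $$\rho_1\le f'(\bar k)\le\rho_2 .$$
   Context: One-dimensional stationary infinite-horizon Ramsey problem ($d=1$): the decision-maker at time $t$ wants to maximise $\int_t^\infty h(s-t)u(c(s))\,ds$ subject to $\frac{dk}{ds}=f(k(s))-c(s)$. The discount function $h:[0,\infty)\to\mathbb{R}$ is continuously differentiable with $h(0)=1$, $h\ge0$, $h'\le0$, $h(t)\to0$ as $t\to\infty$. The utility $u$ is twice continuously differentiable and strictly concave, and its derivative $u'$ has a continuously differentiable inverse $i$ ($u'(c)=x\iff c=i(x)$). The production function $f$ is twice continuously differentiable, strictly concave, and satisfies the Inada conditions $f'(k)\to\infty$ as $k\to0^+$ and $f'(k)\to0$ as $k\to\infty$ (capital $k>0$). Let $\tilde u(x)=\max_c(u(c)-xc)=u(i(x))-x\,i(x)$. Stationary equilibrium strategy: a time-independent strategy $\sigma(k)=i(V'(k))$, where the value function $V(k)$ is a $C^2$ function satisfying $$V(k)=\int_0^\infty h(t)\,u\bigl(i(V'(\mathcal{K}(t,k)))\bigr)\,dt$$ or $$V'(k)f(k)+\int_0^\infty h'(t)\,u\bigl(i(V'(\mathcal{K}(t,k)))\bigr)\,dt+\tilde u(V'(k))=0,$$ where $\mathcal{K}(t,k)$ is the value at time $t$ of the solution of $\frac{dk}{ds}=f(k(s))-\sigma(k(s))$ starting from $k$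 at time $0$. Equilibrium point (for $h$): $\bar k$ is an equilibrium point if there is a stationary equilibrium strategy $\sigma(k)$, defined on a neighbourhood $\Omega$ of $\bar k$, such that all trajectories of $\frac{dk}{dt}=f(k)-\sigma(k)$ starting inside $\Omega$ at $t=0$ converge to $\bar k$ as $t\to\infty$.
   Formalization: The formal theorem adds that the marginal utility u' never vanishes on the admissible consumption levels; without it the claim is false, e.g. u(c) = -(c-1)²/2, h(t) = e^{-t}, f(k) = 2√k, k̄ = 1/4, where f'(k̄) = 2 > 1. *)

theory Defs
  imports "HOL-Analysis.Analysis"
begin

text \<open>The derivative is taken within \<open>S\<close>: two-sided at the points of an open set,
  one-sided at the left end of \<open>{0..}\<close>.\<close>

definition C1_on :: "real set \<Rightarrow> (real \<Rightarrow> real) \<Rightarrow> (real \<Rightarrow> real) \<Rightarrow> bool" where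
  "C1_on S g g' \<longleftrightarrow>
     (\<forall>x\<in>S. (g has_real_derivative g' x) (at x within S)) \<and> continuous_on S g'"

definition C2_on :: "real set \<Rightarrow> (real \<Rightarrow> real) \<Rightarrow> (real \<Rightarrow> real) \<Rightarrow> bool" where
  "C2_on S g g' \<longleftrightarrow> C1_on S g g' \<and> (\<exists>g''. C1_on S g' g'')"

definition strictly_concave_on :: "real set \<Rightarrow> (real \<Rightarrow> real) \<Rightarrow> bool" where
  "strictly_concave_on S g \<longleftrightarrow> convex S \<and>
     (\<forall>x\<in>S. \<forall>y\<in>S. \<forall>s. x \<noteq> y \<longrightarrow> 0 < s \<longrightarrow> s < 1 \<longrightarrow>
        (1 - s) * g x + s * g y < g ((1 - s) * x + s * y))"

definition discount_function :: "(real \<Rightarrow> real) \<Rightarrow> (real \<Rightarrow> real) \<Rightarrow> bool" where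
  "discount_function h h' \<longleftrightarrow>
     C1_on {0..} h h' \<and> h 0 = 1 \<and> (\<forall>t\<ge>0. 0 \<le> h t) \<and> (\<forall>t\<ge>0. h' t \<le> 0) \<and> (h \<longlongrightarrow> 0) at_top"

text \<open>\<open>C\<close> is the set of admissible consumption levels, for instance \<open>UNIV\<close> or \<open>{0<..}\<close>.
  The inverse \<open>i\<close> of \<open>u'\<close> is only meaningful on the range \<open>u' ` C\<close>.\<close>

definition utility_function ::
  "real set \<Rightarrow> (real \<Rightarrow> real) \<Rightarrow> (real \<Rightarrow> real) \<Rightarrow> (real \<Rightarrow> real) \<Rightarrow> bool" where
  "utility_function C u u' i \<longleftrightarrow>
     open C \<and> C2_on C u u' \<and> strictly_concave_on C u \<and>
     (\<forall>c\<in>C. \<forall>x\<in>u' ` C. u' c = x \<longleftrightarrow> c = i x) \<and> (\<exists>i'. C1_on (u' ` C) i i')"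

definition production_function :: "(real \<Rightarrow> real) \<Rightarrow> (real \<Rightarrow> real) \<Rightarrow> bool" where
  "production_function f f' \<longleftrightarrow>
     C2_on {0<..} f f' \<and> strictly_concave_on {0<..} f \<and>
     filterlim f' at_top (at_right 0) \<and> (f' \<longlongrightarrow> 0) at_top"

definition u_tilde :: "real set \<Rightarrow> (real \<Rightarrow> real) \<Rightarrow> real \<Rightarrow> real" where
  "u_tilde C u x = (SUP c\<in>C. u c - x * c)"

text \<open>The supremum is attained at \<open>i x\<close>.\<close>

lemma u_tilde_eq:
  assumes "utility_function C u u' i" and "x \<in> u' ` C"
  shows "u_tilde C u x = u (i x) - x * i x"
proof -
  from assms(2) obtain c0 where c0: "c0 \<in> C" "x = u' c0" by blast
  have i: "i x = c0" using assms c0 by (metis utility_function_def)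
  have sc: "strictly_concave_on C u" and C: "open C"
    and der: "(u has_real_derivative u' c0) (at c0 within C)"
    using assms(1) c0 by (auto simp: utility_function_def C2_on_def C1_on_def)
  have conv: "convex C" using sc by (simp add: strictly_concave_on_def)
  have convex: "convex_on C (\<lambda>c. - u c)"
  proof (rule convex_onI)
    fix t a b :: real
    assume *: "0 < t" "t < 1" "a \<in> C" "b \<in> C"
    show "- u ((1 - t) *\<^sub>R a + t *\<^sub>R b) \<le> (1 - t) * - u a + t * - u b"
    proof (cases "a = b")
      case True
      then show ?thesis by (simp add: algebra_simps)
    next
      case False
      with * sc have "(1 - t) * u a + t * u b < u ((1 - t) * a + t * b)"
        unfolding strictly_concave_on_def by blast
      then show ?thesis by simp
    qed
  qed (rule conv)
  have "((\<lambda>c. - u c) has_real_derivative - u' c0) (at c0 within C)"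
    by (intro derivative_intros der)
  moreover have "c0 \<in> interior C" using C c0 by (simp add: interior_open)
  ultimately have "- u c - - u c0 \<ge> - u' c0 * (c - c0)" if "c \<in> C" for c
    using convex_on_imp_above_tangent[OF convex convex_connected[OF conv]] that by blast
  then have "u c - x * c \<le> u c0 - x * c0" if "c \<in> C" for c
    using that c0 by (fastforce simp: algebra_simps)
  then show ?thesis
    unfolding u_tilde_def i using c0 by (intro cSup_eq_maximum) auto
qed

text \<open>Since \<open>\<sigma>\<close> is only defined on \<open>\<Omega>\<close>, a trajectory has to stay in \<open>\<Omega>\<close>.\<close>

definition trajectory ::
  "(real \<Rightarrow> real) \<Rightarrow> real set \<Rightarrow> (real \<Rightarrow> real) \<Rightarrow> real \<Rightarrow> (real \<Rightarrow> real) \<Rightarrow> bool" where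
  "trajectory f \<Omega> \<sigma> k x \<longleftrightarrow> x 0 = k \<and>
     (\<forall>t\<ge>0. x t \<in> \<Omega> \<and> (x has_real_derivative f (x t) - \<sigma> (x t)) (at t within {0..}))"

text \<open>\<open>K t k\<close> is the value at time \<open>t\<close> of the solution starting from \<open>k\<close>; the
  right-hand side \<open>f - \<sigma>\<close> of the equation is continuously differentiable on the open set
  \<open>\<Omega>\<close>, so this solution is unique. The integrals over \<open>{0..}\<close> are Henstock-Kurzweil
  integrals, hence include convergent improper ones, and their existence is part of the two
  equations. The second equation is the first one differentiated along trajectories.\<close>

definition stationary_equilibrium_strategy where
  "stationary_equilibrium_strategy C u u' i f h h' \<Omega> \<sigma> \<longleftrightarrow>
     open \<Omega> \<and> \<Omega> \<subseteq> {0<..} \<and>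
     (\<exists>V V' K.
        C2_on \<Omega> V V' \<and>
        (\<forall>k\<in>\<Omega>. V' k \<in> u' ` C \<and> \<sigma> k = i (V' k)) \<and>
        (\<forall>k\<in>\<Omega>. trajectory f \<Omega> \<sigma> k (\<lambda>t. K t k)) \<and>
        ((\<forall>k\<in>\<Omega>. ((\<lambda>t. h t * u (i (V' (K t k)))) has_integral V k) {0..}) \<or>
         (\<forall>k\<in>\<Omega>. \<exists>J. ((\<lambda>t. h' t * u (i (V' (K t k)))) has_integral J) {0..} \<and>
                     V' k * f k + J + u_tilde C u (V' k) = 0)))"

definition equilibrium_point where
  "equilibrium_point C u u' i f h h' kbar \<longleftrightarrow>
     (\<exists>\<Omega> \<sigma>. stationary_equilibrium_strategy C u u' i f h h' \<Omega> \<sigma> \<and> kbar \<in> \<Omega> \<and>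
        (\<forall>k\<in>\<Omega>. \<forall>x. trajectory f \<Omega> \<sigma> k x \<longrightarrow> (x \<longlongrightarrow> kbar) at_top))"

end

theory Submission
  imports Defs
begin

text \<open>Write \<open>F = f - \<sigma>\<close> for the velocity field and \<open>g = u \<circ> \<sigma>\<close> for the payoff on \<open>\<Omega>\<close>. Since \<open>u' (\<sigma> k) = V' k\<close>,
  the payoff has derivative \<open>g' = V' * \<sigma>'\<close>. Attraction forces \<open>F kbar = 0\<close> and \<open>F' kbar = - a\<close> with \<open>a \<ge> 0\<close>,
  that is \<open>\<sigma>' kbar = f' kbar + a\<close>. Displacements from \<open>kbar\<close> decay roughly like \<open>exp (- a * t)\<close>. Hence,
  to first order at \<open>kbar\<close>, either form of the equilibrium equation says
  \<open>V' kbar = V' kbar * \<sigma>' kbar * I\<close>, where \<open>I\<close> is the integral of \<open>h t * exp (- a * t)\<close>. As \<open>V' kbar\<close> does not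
  vanish, \<open>f' kbar + a = 1 / I\<close>, and the exponential bounds on \<open>h\<close> place \<open>1 / I\<close> between
  \<open>\<rho>\<^sub>1 + a\<close> and \<open>\<rho>\<^sub>2 + a\<close>.

  The argument neither differentiates the flow in its initial value nor uses uniqueness of
  trajectories. It works with one trajectory that starts close to \<open>kbar\<close> and with a weight
  \<open>z\<close> normalised by \<open>z 0 = 1\<close> and satisfying \<open>z' = - a * z\<close> up to a small relative error. For the integral
  equation the weight is the relative displacement \<open>(K t k - kbar) / (k - kbar)\<close>
  (\<open>response_of_value\<close>), for the differentiated equation it is the relative velocity
  \<open>F (K t k) / F k\<close> (\<open>response_of_velocity\<close>). The passage from such weights to the
  bounds on the rate is \<open>rate_from_responses\<close>. Because \<open>a = 0\<close> is possible, convergence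
  to \<open>kbar\<close> need not be exponential; integrability at infinity comes from the decay of \<open>h\<close>.\<close>

section \<open>Growth rates and discounted integrals on the half-line\<close>

lemma deriv_within_imp_continuous_on:
  fixes x D :: "real \<Rightarrow> real"
  assumes "\<forall>t\<ge>0. (x has_real_derivative D t) (at t within {0..})"
  shows "continuous_on {0..} x"
  unfolding continuous_on_eq_continuous_within
proof
  fix t :: real assume "t \<in> {0..}"
  then show "continuous (at t within {0..}) x"
    using assms by (intro DERIV_continuous[of x "D t"]) simp
qed

lemma has_real_derivative_atLeast_interior:
  fixes x :: "real \<Rightarrow> real"
  assumes "(x has_real_derivative D) (at t within {0..})" "0 < t"
  shows "(x has_real_derivative D) (at t)"
  using assms at_within_interior[of t "{0..}"] by simp

lemma antimono_if_deriv_nonpos: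
  fixes x D :: "real \<Rightarrow> real"
  assumes der: "\<forall>t\<ge>0. (x has_real_derivative D t) (at t within {0..})"
    and "\<forall>t\<ge>0. D t \<le> 0" and "0 \<le> t"
  shows "x t \<le> x 0"
proof (rule DERIV_nonpos_imp_decreasing_open[of 0 t x])
  show "continuous_on {0..t} x"
    using deriv_within_imp_continuous_on[OF der] by (rule continuous_on_subset) auto
  show "\<exists>y. DERIV x s :> y \<and> y \<le> 0" if "0 < s" "s < t" for s
  proof (intro exI conjI)
    show "DERIV x s :> D s"
      using has_real_derivative_atLeast_interior[of x "D s" s] der that by simp
    show "D s \<le> 0" using assms(2) that by simp
  qed
qed (rule assms)

lemma mono_if_deriv_nonneg:
  fixes x D :: "real \<Rightarrow> real"
  assumes der: "\<forall>t\<ge>0. (x has_real_derivative D t) (at t within {0..})"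
    and "\<forall>t\<ge>0. 0 \<le> D t" and "0 \<le> t"
  shows "x 0 \<le> x t"
proof -
  have "\<forall>t\<ge>0. ((\<lambda>t. - x t) has_real_derivative - D t) (at t within {0..})"
    using der by (intro allI impI DERIV_minus) simp
  then have "- x t \<le> - x 0"
    by (rule antimono_if_deriv_nonpos) (use assms in auto)
  then show ?thesis by simp
qed

text \<open>A Gronwall estimate for a function that satisfies \<open>z' = - a * z\<close> up to a relative
  error \<open>e\<close>. It follows from the monotonicity of \<open>z\<^sup>2\<close> times an exponential, so that positivity
  of \<open>z\<close> is a conclusion and not a hypothesis.\<close>

lemma near_exponential_decay:
  fixes z D :: "real \<Rightarrow> real"
  assumes z0: "z 0 = 1"
    and der: "\<forall>t\<ge>0. (z has_real_derivative D t) (at t within {0..})"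
    and D: "\<forall>t\<ge>0. \<bar>D t + a * z t\<bar> \<le> e * \<bar>z t\<bar>"
    and t: "0 \<le> t"
  shows "exp (- (a + e) * t) \<le> z t" and "z t \<le> exp (- (a - e) * t)"
proof -
  have zD: "\<bar>z s * D s + a * (z s)\<^sup>2\<bar> \<le> e * (z s)\<^sup>2" if "s \<ge> 0" for s
  proof -
    have "\<bar>z s\<bar> * \<bar>D s + a * z s\<bar> \<le> \<bar>z s\<bar> * (e * \<bar>z s\<bar>)"
      using D that by (intro mult_left_mono) auto
    also have "\<dots> = e * (z s)\<^sup>2"
      by (simp add: power2_eq_square mult.left_commute)
    finally show ?thesis
      by (simp add: abs_mult[symmetric] algebra_simps power2_eq_square)
  qed
  have sq: "((\<lambda>t. (z t)\<^sup>2 * exp (2 * r * t)) has_real_derivative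
         2 * (z s * D s + r * (z s)\<^sup>2) * exp (2 * r * s)) (at s within {0..})"
    if "s \<ge> 0" for s r
    using der that
    by (auto intro!: derivative_eq_intros simp: algebra_simps power2_eq_square)
  have *: "1 \<le> (z s)\<^sup>2 * exp (2 * (a + e) * s)" if s: "0 \<le> s" for s
  proof -
    have "\<forall>t\<ge>0. 0 \<le> 2 * (z t * D t + (a + e) * (z t)\<^sup>2) * exp (2 * (a + e) * t)"
    proof (intro allI impI)
      fix t :: real assume "0 \<le> t"
      have "0 \<le> z t * D t + (a + e) * (z t)\<^sup>2"
        using zD[OF \<open>0 \<le> t\<close>] by (simp only: distrib_right abs_le_iff) linarith
      then show "0 \<le> 2 * (z t * D t + (a + e) * (z t)\<^sup>2) * exp (2 * (a + e) * t)"
        by simp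
    qed
    with sq[of _ "a + e"] have "(z 0)\<^sup>2 * exp (2 * (a + e) * 0) \<le> (z s)\<^sup>2 * exp (2 * (a + e) * s)"
      by (intro mono_if_deriv_nonneg[OF _ _ s, where x = "\<lambda>t. (z t)\<^sup>2 * exp (2 * (a + e) * t)"
            and D = "\<lambda>s. 2 * (z s * D s + (a + e) * (z s)\<^sup>2) * exp (2 * (a + e) * s)"]) simp_all
    then show ?thesis by (simp add: z0)
  qed
  have **: "(z t)\<^sup>2 * exp (2 * (a - e) * t) \<le> 1"
  proof -
    have "\<forall>t\<ge>0. 2 * (z t * D t + (a - e) * (z t)\<^sup>2) * exp (2 * (a - e) * t) \<le> 0"
    proof (intro allI impI)
      fix t :: real assume "0 \<le> t"
      have "z t * D t + (a - e) * (z t)\<^sup>2 \<le> 0"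
        using zD[OF \<open>0 \<le> t\<close>] by (simp only: left_diff_distrib abs_le_iff) linarith
      then show "2 * (z t * D t + (a - e) * (z t)\<^sup>2) * exp (2 * (a - e) * t) \<le> 0"
        by (simp add: mult_le_0_iff)
    qed
    with sq[of _ "a - e"] have "(z t)\<^sup>2 * exp (2 * (a - e) * t) \<le> (z 0)\<^sup>2 * exp (2 * (a - e) * 0)"
      by (intro antimono_if_deriv_nonpos[OF _ _ t, where x = "\<lambda>t. (z t)\<^sup>2 * exp (2 * (a - e) * t)"
            and D = "\<lambda>s. 2 * (z s * D s + (a - e) * (z s)\<^sup>2) * exp (2 * (a - e) * s)"]) simp_all
    then show ?thesis by (simp add: z0)
  qed
  have nonzero: "z s \<noteq> 0" if "0 \<le> s" for s
    using *[OF that] by auto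
  have pos: "0 < z t"
  proof (rule ccontr)
    assume "\<not> 0 < z t"
    moreover have "continuous_on {0..t} z"
      using deriv_within_imp_continuous_on[OF der] by (rule continuous_on_subset) auto
    ultimately obtain s where "0 \<le> s" "z s = 0"
      using IVT2'[of z t 0 0] t z0 by auto
    then show False using nonzero by blast
  qed
  have sq_exp: "(z t * exp (r * t))\<^sup>2 = (z t)\<^sup>2 * exp (2 * r * t)" for r
    by (simp only: power_mult_distrib mult.assoc exp_double)
  have exp_neg: "exp (- r * t) = 1 / exp (r * t)" for r
    by (simp add: exp_minus inverse_eq_divide)
  have "1\<^sup>2 \<le> (z t * exp ((a + e) * t))\<^sup>2"
    unfolding sq_exp using *[OF t] by simp
  then have "1 \<le> z t * exp ((a + e) * t)"
    by (rule power2_le_imp_le) (use pos in simp)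
  then show "exp (- (a + e) * t) \<le> z t"
    unfolding exp_neg by (simp add: divide_le_eq)
  have "(z t * exp ((a - e) * t))\<^sup>2 \<le> 1\<^sup>2"
    unfolding sq_exp using ** by simp
  then have "z t * exp ((a - e) * t) \<le> 1"
    by (rule power2_le_imp_le) simp
  then show "z t \<le> exp (- (a - e) * t)"
    unfolding exp_neg by (simp add: le_divide_eq)
qed

lemma exp_decay_mult:
  fixes a b t :: real
  shows "exp (- a * t) * exp (- b * t) = exp (- (a + b) * t)"
  unfolding exp_add[symmetric] by (simp add: algebra_simps)

lemma has_integral_exp_decay:
  fixes c :: real
  assumes "0 < c"
  shows "((\<lambda>t. exp (- c * t)) has_integral 1 / c) {0..}"
  using has_integral_exp_minus_to_infinity[OF assms, of 0] by simp

lemma integrable_atLeast_if_dominated: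
  fixes g B :: "real \<Rightarrow> real"
  assumes g: "continuous_on {0..} g" and "\<And>t. 0 \<le> t \<Longrightarrow> \<bar>g t\<bar> \<le> B t" and "B integrable_on {0..}"
  shows "g integrable_on {0..}"
proof (rule integrable_on_all_intervals_integrable_bound)
  fix a b :: real
  have "g integrable_on {0..} \<inter> cbox a b"
  proof -
    have "{0..} \<inter> cbox a b = {max 0 a..b}" by auto
    then show ?thesis
      using continuous_on_subset[OF g, of "{max 0 a..b}"]
      by (auto intro: integrable_continuous_interval)
  qed
  then show "(\<lambda>t. if t \<in> {0..} then g t else 0) integrable_on cbox a b"
    by (simp only: integrable_restrict_Int)
qed (use assms in auto)

lemma has_integral_derivative_Icc:
  fixes G D :: "real \<Rightarrow> real"
  assumes "\<forall>t\<ge>0. (G has_real_derivative D t) (at t within {0..})" and "0 \<le> T"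
  shows "(D has_integral G T - G 0) {0..T}"
  using assms
  by (intro fundamental_theorem_of_calculus)
    (auto simp flip: has_real_derivative_iff_has_vector_derivative intro: has_field_derivative_subset)

text \<open>The fundamental theorem of calculus on a half-line, for a derivative that is dominated by
  an integrable function but need not be continuous.\<close>

lemma has_integral_derivative_atLeast:
  fixes G D B :: "real \<Rightarrow> real"
  assumes der: "\<forall>t\<ge>0. (G has_real_derivative D t) (at t within {0..})"
    and bound: "\<And>t. 0 \<le> t \<Longrightarrow> \<bar>D t\<bar> \<le> B t" and B: "B integrable_on {0..}"
    and lim: "(G \<longlongrightarrow> L) at_top"
  shows "(D has_integral L - G 0) {0..}"
proof (rule has_integral_dominated_convergence[OF _ B])
  let ?f = "\<lambda>n t. if t \<in> {0..real n} then D t else 0"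
  show "(?f n has_integral G (real n) - G 0) {0..}" for n
    using has_integral_derivative_Icc[OF der, of "real n"]
    by (subst has_integral_restrict) auto
  show "\<forall>t\<in>{0..}. norm (?f n t) \<le> B t" for n
    using bound by (auto intro: order_trans[OF abs_ge_zero])
  show "\<forall>t\<in>{0..}. (\<lambda>n. ?f n t) \<longlonglongrightarrow> D t"
  proof
    fix t :: real assume "t \<in> {0..}"
    then have "eventually (\<lambda>n. ?f n t = D t) sequentially"
      by (intro eventually_mono[OF eventually_ge_at_top[of "nat \<lceil>t\<rceil>"]])
        (auto simp: nat_le_iff ceiling_le_iff)
    then show "(\<lambda>n. ?f n t) \<longlonglongrightarrow> D t" by (rule tendsto_eventually)
  qed
  show "(\<lambda>n. G (real n) - G 0) \<longlonglongrightarrow> L - G 0"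
    by (intro tendsto_intros filterlim_compose[OF lim filterlim_real_sequentially])
qed

lemma discount_derivative_integrable:
  assumes "discount_function h h'"
  shows "h' integrable_on {0..}"
proof -
  have der: "\<forall>t\<ge>0. (h has_real_derivative h' t) (at t within {0..})"
    and h': "\<forall>t\<ge>0. h' t \<le> 0" and lim: "(h \<longlongrightarrow> 0) at_top"
    using assms by (auto simp: discount_function_def C1_on_def)
  have int: "(h' has_integral h y - h 0) {0..y}" if "0 \<le> y" for y
    using has_integral_derivative_Icc[OF der that] .
  have "((\<lambda>t. - h' t) has_integral h 0) {0..}"
  proof (rule has_integral_to_inf)
    show "(\<lambda>t. - h' t) integrable_on {0..y}" for y
    proof (cases "0 \<le> y")
      case True
      then show ?thesis using int integrable_neg by blast
    qed auto
    have "((\<lambda>y. h 0 - h y) \<longlongrightarrow> h 0 - 0) at_top"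
      by (intro tendsto_intros lim)
    moreover have "\<forall>\<^sub>F y in at_top. h 0 - h y = integral {0..y} (\<lambda>t. - h' t)"
      using eventually_ge_at_top[of 0]
      by eventually_elim (use int in \<open>force dest: integral_unique\<close>)
    ultimately show "((\<lambda>y. integral {0..y} (\<lambda>t. - h' t)) \<longlongrightarrow> h 0) at_top"
      by (simp add: tendsto_cong)
  qed (use h' in auto)
  then show ?thesis
    using has_integral_integrable integrable_neg_iff by blast
qed

section \<open>The rate forced by an approximately exponential response\<close>

text \<open>\<open>P\<close> is the discounted integral of a function close to \<open>s * z\<close>, where the weight \<open>z\<close> lies between
  two exponentials; \<open>I\<close> is the discounted integral of \<open>z\<close> itself.\<close>

lemma discounted_response:
  fixes h z q :: "real \<Rightarrow> real"
  assumes cont: "continuous_on {0..} h" "continuous_on {0..} z"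
    and h: "\<forall>t\<ge>0. exp (- r2 * t) \<le> h t \<and> h t \<le> exp (- r1 * t)"
    and z: "\<forall>t\<ge>0. exp (- b2 * t) \<le> z t \<and> z t \<le> exp (- b1 * t)"
    and pos: "0 < r1 + b1" "0 < r2 + b2"
    and q: "\<forall>t\<ge>0. \<bar>q t - s * z t\<bar> \<le> e * \<bar>z t\<bar>"
    and P: "((\<lambda>t. h t * q t) has_integral P) {0..}"
  obtains I where "1 / (r2 + b2) \<le> I" "I \<le> 1 / (r1 + b1)" "\<bar>P - s * I\<bar> \<le> e * I"
proof -
  have nonneg: "0 \<le> h t" "0 \<le> z t" if "0 \<le> t" for t
    using h z that by (meson exp_ge_zero order_trans)+
  have ub: "h t * z t \<le> exp (- (r1 + b1) * t)" if "0 \<le> t" for t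
  proof -
    have "h t * z t \<le> exp (- r1 * t) * exp (- b1 * t)"
      using h z that nonneg by (intro mult_mono) auto
    then show ?thesis by (simp only: exp_decay_mult)
  qed
  have lb: "exp (- (r2 + b2) * t) \<le> h t * z t" if "0 \<le> t" for t
  proof -
    have "exp (- r2 * t) * exp (- b2 * t) \<le> h t * z t"
      using h z that nonneg by (intro mult_mono) auto
    then show ?thesis by (simp only: exp_decay_mult)
  qed
  have "(\<lambda>t. h t * z t) integrable_on {0..}"
  proof (rule integrable_atLeast_if_dominated)
    show "(\<lambda>t. exp (- (r1 + b1) * t)) integrable_on {0..}"
      using has_integral_exp_decay[OF pos(1)] by blast
  qed (use cont ub nonneg in \<open>auto intro!: continuous_intros\<close>)
  then obtain I where I: "((\<lambda>t. h t * z t) has_integral I) {0..}"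
    by blast
  have "1 / (r2 + b2) \<le> I"
    using has_integral_le[OF has_integral_exp_decay[OF pos(2)] I] lb by simp
  moreover have "I \<le> 1 / (r1 + b1)"
    using has_integral_le[OF I has_integral_exp_decay[OF pos(1)]] ub by simp
  moreover have "\<bar>P - s * I\<bar> \<le> e * I"
  proof -
    have diff: "((\<lambda>t. h t * q t - s * (h t * z t)) has_integral P - s * I) {0..}"
      by (intro has_integral_diff P has_integral_mult_right I)
    have *: "\<bar>h t * q t - s * (h t * z t)\<bar> \<le> e * (h t * z t)" if "0 \<le> t" for t
    proof -
      have "h t * q t - s * (h t * z t) = h t * (q t - s * z t)"
        by (simp add: algebra_simps)
      then have "\<bar>h t * q t - s * (h t * z t)\<bar> = h t * \<bar>q t - s * z t\<bar>"
        using nonneg[OF that] by (simp add: abs_mult)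
      also have "\<dots> \<le> h t * (e * z t)"
        using q nonneg[OF that] that by (intro mult_left_mono) auto
      finally show ?thesis by (simp add: algebra_simps)
    qed
    have "P - s * I \<le> e * I"
      using * by (intro has_integral_le[OF diff has_integral_mult_right[OF I]]) (simp add: abs_le_iff)
    moreover have "- (e * I) \<le> P - s * I"
      using *
      by (intro has_integral_le[OF has_integral_neg[OF has_integral_mult_right[OF I]] diff])
        (force simp: abs_le_iff)
    ultimately show ?thesis by linarith
  qed
  ultimately show ?thesis by (rule that)
qed

text \<open>In the limit \<open>e \<rightarrow> 0\<close> the hypothesis reads \<open>p = p * m * I\<close> with \<open>1 / I\<close> between \<open>r1 + a\<close> and \<open>r2 + a\<close>.
  No convergence of \<open>I\<close> is assumed, so the bounds on \<open>m\<close> are first proved with an error of order \<open>e\<close>.\<close>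

lemma rate_between:
  fixes p m a r1 r2 :: real
  assumes p: "p \<noteq> 0" and r: "0 < r1" "r1 \<le> r2" and a: "0 \<le> a"
    and approx: "\<And>e. 0 < e \<Longrightarrow> e < r1 \<Longrightarrow>
      \<exists>P I. \<bar>P - p\<bar> \<le> e \<and> 1 / (r2 + (a + e)) \<le> I \<and> I \<le> 1 / (r1 + (a - e)) \<and> \<bar>P - p * m * I\<bar> \<le> e * I"
  shows "r1 + a \<le> m \<and> m \<le> r2 + a"
proof -
  \<comment> \<open>The summand \<open>r1\<close> absorbs \<open>e < r1\<close> in the bound \<open>1 / I + 1 \<le> 1 + r2 + a + e\<close>.\<close>
  define M where "M = 1 + (1 + r2 + a + r1) / \<bar>p\<bar>"
  have "0 < M" using p r a by (simp add: M_def add_pos_nonneg)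
  have bounds: "r1 + a - e * M \<le> m \<and> m \<le> r2 + a + e * M" if e: "0 < e" "e < r1" for e
  proof -
    obtain P I where PI: "\<bar>P - p\<bar> \<le> e" "1 / (r2 + (a + e)) \<le> I" "I \<le> 1 / (r1 + (a - e))"
      "\<bar>P - p * m * I\<bar> \<le> e * I"
      using approx[OF e] by blast
    have I: "0 < I"
    proof -
      have "0 < 1 / (r2 + (a + e))" using r a e by simp
      then show ?thesis using PI(2) by linarith
    qed
    define v where "v = 1 / I"
    have v: "v \<le> r2 + a + e" "r1 + a - e \<le> v" "0 < v"
    proof -
      have "1 / I \<le> 1 / (1 / (r2 + (a + e)))"
        using PI(2) I r a e by (intro divide_left_mono) auto
      then show "v \<le> r2 + a + e" by (simp add: v_def)
      have "1 / (1 / (r1 + (a - e))) \<le> 1 / I"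
        using PI(3) I r a e by (intro divide_left_mono) auto
      then show "r1 + a - e \<le> v" by (simp add: v_def)
      show "0 < v" using I by (simp add: v_def)
    qed
    have "\<bar>p - p * m * I\<bar> \<le> e + e * I"
      using PI(1,4) by linarith
    then have "\<bar>p - p * m * I\<bar> * v \<le> (e + e * I) * v"
      using v by (intro mult_right_mono) auto
    also have "\<bar>p - p * m * I\<bar> * v = \<bar>p\<bar> * \<bar>v - m\<bar>"
    proof -
      have "\<bar>p - p * m * I\<bar> * v = \<bar>(p - p * m * I) * v\<bar>"
        using v by (simp add: abs_mult)
      also have "(p - p * m * I) * v = p * (v - m)"
        using I by (simp add: v_def field_simps)
      finally show ?thesis by (simp add: abs_mult)
    qed
    also have "(e + e * I) * v = e * (v + 1)"
      using I by (simp add: v_def field_simps)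
    also have "\<dots> \<le> e * (1 + r2 + a + r1)"
      using v e by (intro mult_left_mono) auto
    finally have "\<bar>v - m\<bar> \<le> e * (1 + r2 + a + r1) / \<bar>p\<bar>"
      using p by (simp add: pos_le_divide_eq mult.commute)
    moreover have "e * M = e + e * (1 + r2 + a + r1) / \<bar>p\<bar>"
      by (simp add: M_def ring_distribs)
    ultimately have "\<bar>v - m\<bar> + e \<le> e * M"
      by linarith
    then show ?thesis using v by linarith
  qed
  have "r1 + a \<le> m + d \<and> m \<le> r2 + a + d" if d: "0 < d" for d
  proof -
    define e where "e = min (d / M) (r1 / 2)"
    have e: "0 < e" "e < r1" using d \<open>0 < M\<close> r by (auto simp: e_def)
    have "e * M \<le> d / M * M"
      using \<open>0 < M\<close> by (intro mult_right_mono) (auto simp: e_def)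
    then have "e * M \<le> d" using \<open>0 < M\<close> by simp
    then show ?thesis using bounds[OF e] by linarith
  qed
  then show ?thesis by (auto intro: field_le_epsilon)
qed

text \<open>In the response hypothesis \<open>z\<close> is a weight decaying at rate about \<open>a\<close>, \<open>q\<close> is about \<open>p * m * z\<close>, and
  the discounted integral \<open>P\<close> of \<open>q\<close> is about \<open>p\<close>. The restriction \<open>e < r1\<close> keeps \<open>h * z\<close> integrable
  even if \<open>a = 0\<close>, when \<open>z\<close> may be bounded only by \<open>exp (e * t)\<close>.\<close>

lemma rate_from_responses:
  fixes h :: "real \<Rightarrow> real" and p m a r1 r2 :: real
  assumes p: "p \<noteq> 0" and r: "0 < r1" "r1 \<le> r2" and a: "0 \<le> a"
    and cont: "continuous_on {0..} h"
    and h: "\<forall>t\<ge>0. exp (- r2 * t) \<le> h t \<and> h t \<le> exp (- r1 * t)"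
    and response: "\<And>e. 0 < e \<Longrightarrow> e < r1 \<Longrightarrow> \<exists>z D q P. z 0 = 1 \<and>
      (\<forall>t\<ge>0. (z has_real_derivative D t) (at t within {0..})) \<and>
      (\<forall>t\<ge>0. \<bar>D t + a * z t\<bar> \<le> e * \<bar>z t\<bar>) \<and>
      (\<forall>t\<ge>0. \<bar>q t - p * m * z t\<bar> \<le> e * \<bar>z t\<bar>) \<and>
      ((\<lambda>t. h t * q t) has_integral P) {0..} \<and> \<bar>P - p\<bar> \<le> e"
  shows "r1 + a \<le> m \<and> m \<le> r2 + a"
proof (rule rate_between[OF p r a])
  fix e assume e: "0 < e" "e < r1"
  obtain z D q P where z: "z 0 = 1" "\<forall>t\<ge>0. (z has_real_derivative D t) (at t within {0..})"
      "\<forall>t\<ge>0. \<bar>D t + a * z t\<bar> \<le> e * \<bar>z t\<bar>"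
    and q: "\<forall>t\<ge>0. \<bar>q t - p * m * z t\<bar> \<le> e * \<bar>z t\<bar>"
    and P: "((\<lambda>t. h t * q t) has_integral P) {0..}" "\<bar>P - p\<bar> \<le> e"
    using response[OF e] by (elim exE conjE) (rule that; assumption)
  obtain I where "1 / (r2 + (a + e)) \<le> I" "I \<le> 1 / (r1 + (a - e))" "\<bar>P - p * m * I\<bar> \<le> e * I"
  proof (rule discounted_response[OF cont deriv_within_imp_continuous_on[OF z(2)] h _ _ _ q P(1)])
    show "\<forall>t\<ge>0. exp (- (a + e) * t) \<le> z t \<and> z t \<le> exp (- (a - e) * t)"
      using near_exponential_decay[OF z] by blast
  qed (use r a e in auto)
  with P(2) show "\<exists>P I. \<bar>P - p\<bar> \<le> e \<and> 1 / (r2 + (a + e)) \<le> I \<and> I \<le> 1 / (r1 + (a - e)) \<and>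
      \<bar>P - p * m * I\<bar> \<le> e * I"
    by blast
qed

section \<open>Attracting points of one-dimensional flows\<close>

lemma eventually_linear_approx:
  fixes g :: "real \<Rightarrow> real"
  assumes "(g has_real_derivative D) (at b)" and "0 < e"
  shows "\<forall>\<^sub>F k in nhds b. \<bar>g k - g b - D * (k - b)\<bar> \<le> e * \<bar>k - b\<bar>"
  using assms unfolding has_field_derivative_def has_derivative_at_alt eventually_nhds_metric
  by (auto simp: dist_real_def)

lemma eventually_close:
  fixes g :: "real \<Rightarrow> real"
  assumes "continuous_on \<Omega> g" "open \<Omega>" "b \<in> \<Omega>" "0 < e"
  shows "\<forall>\<^sub>F k in nhds b. \<bar>g k - g b\<bar> \<le> e"
proof -
  have "(g \<longlongrightarrow> g b) (nhds b)"
    using assms by (simp add: continuous_on_eq_continuous_at isCont_def tendsto_at_iff_tendsto_nhds)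
  from tendstoD[OF this assms(4)] show ?thesis
    by eventually_elim (simp add: dist_real_def)
qed

text \<open>A function that starts at \<open>k\<close> and has a limit below \<open>k\<close> passes \<open>k\<close> for a last time, and its derivative
  there cannot be positive.\<close>

lemma last_passage_derivative_nonpos:
  fixes x :: "real \<Rightarrow> real"
  assumes cont: "continuous_on {0..} x" and x0: "x 0 = k" and lim: "(x \<longlongrightarrow> b) at_top" and "b < k"
    and der: "\<And>t. 0 \<le> t \<Longrightarrow> x t = k \<Longrightarrow> (x has_real_derivative D) (at t within {0..})"
  shows "D \<le> 0"
proof (rule ccontr)
  assume "\<not> D \<le> 0"
  then have D: "0 < D" by simp
  obtain T where T: "\<And>t. T \<le> t \<Longrightarrow> x t < k"
    using order_tendstoD(2)[OF lim \<open>b < k\<close>] by (auto simp: eventually_at_top_linorder)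
  define S where "S = {t \<in> {0..}. x t = k}"
  have "0 \<in> S" by (simp add: S_def x0)
  have "S \<subseteq> {0..T}"
  proof
    fix t assume "t \<in> S"
    then show "t \<in> {0..T}" using T[of t] by (cases "T \<le> t") (auto simp: S_def)
  qed
  have "closed S"
    using continuous_closed_preimage_constant[OF cont, of k] by (simp add: S_def)
  then have "compact S"
    using \<open>S \<subseteq> {0..T}\<close> by (meson bounded_closed_interval bounded_subset compact_eq_bounded_closed)
  then obtain t where t: "t \<in> S" and last: "\<And>s. s \<in> S \<Longrightarrow> s \<le> t"
    using compact_attains_sup[of S] \<open>0 \<in> S\<close> by auto
  have "0 \<le> t" "x t = k" using t by (auto simp: S_def)
  then obtain d where d: "d > 0" "\<And>\<epsilon>. 0 < \<epsilon> \<Longrightarrow> \<epsilon> < d \<Longrightarrow> x t < x (t + \<epsilon>)"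
    using has_real_derivative_pos_inc_right[OF der D] by (metis add_nonneg_nonneg atLeast_iff less_imp_le)
  then have up: "k < x (t + d / 2)" using \<open>x t = k\<close> d(2)[of "d / 2"] by simp
  have "\<exists>s. t + d / 2 \<le> s \<and> s \<le> max T (t + d) \<and> x s = k"
  proof (rule IVT2')
    show "x (max T (t + d)) \<le> k" using T[of "max T (t + d)"] by simp
    show "continuous_on {t + d / 2..max T (t + d)} x"
      using \<open>0 \<le> t\<close> d(1) by (intro continuous_on_subset[OF cont]) auto
  qed (use up d(1) in auto)
  then obtain s where "t + d / 2 \<le> s" "x s = k" by blast
  then have "t < s" using d(1) by linarith
  then show False using last[of s] \<open>0 \<le> t\<close> \<open>x s = k\<close> by (auto simp: S_def)
qed

text \<open>\<open>K t k\<close> is a solution of \<open>k' = F k\<close> that starts at \<open>k\<close>, stays in \<open>\<Omega>\<close> and converges to \<open>b\<close>. One solution is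
  chosen for each \<open>k\<close>; neither a flow law nor uniqueness is required.\<close>

locale attracting_point =
  fixes \<Omega> :: "real set" and F :: "real \<Rightarrow> real" and K :: "real \<Rightarrow> real \<Rightarrow> real" and b :: real
  assumes open_domain: "open \<Omega>" and point_in: "b \<in> \<Omega>"
    and start: "k \<in> \<Omega> \<Longrightarrow> K 0 k = k"
    and stays: "k \<in> \<Omega> \<Longrightarrow> 0 \<le> t \<Longrightarrow> K t k \<in> \<Omega>"
    and solves: "k \<in> \<Omega> \<Longrightarrow> 0 \<le> t \<Longrightarrow>
      ((\<lambda>t. K t k) has_real_derivative F (K t k)) (at t within {0..})"
    and converges: "k \<in> \<Omega> \<Longrightarrow> ((\<lambda>t. K t k) \<longlongrightarrow> b) at_top"
begin

lemma inward:
  assumes k: "k \<in> \<Omega>"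
  shows "(k - b) * F k \<le> 0"
proof -
  have der: "\<forall>t\<ge>0. ((\<lambda>t. K t k) has_real_derivative F (K t k)) (at t within {0..})"
    using solves[OF k] by blast
  note cont = deriv_within_imp_continuous_on[OF der]
  consider "b < k" | "k < b" | "k = b" by linarith
  then show ?thesis
  proof cases
    case 1
    then have "F k \<le> 0"
      using last_passage_derivative_nonpos[OF cont start[OF k] converges[OF k]] der by metis
    then show ?thesis using 1 by (simp add: mult_le_0_iff)
  next
    case 2
    have "- F k \<le> 0"
    proof (rule last_passage_derivative_nonpos[of "\<lambda>t. - K t k" "- k" "- b"])
      show "((\<lambda>t. - K t k) has_real_derivative - F k) (at t within {0..})"
        if "0 \<le> t" "- K t k = - k" for t
        using DERIV_minus[OF solves[OF k that(1)]] that(2) by simp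
    qed (use 2 start[OF k] cont converges[OF k] in \<open>auto intro!: continuous_intros tendsto_intros\<close>)
    then show ?thesis using 2 by (simp add: mult_le_0_iff)
  qed simp
qed

lemma distance_nonincreasing:
  assumes k: "k \<in> \<Omega>" and t: "0 \<le> t"
  shows "\<bar>K t k - b\<bar> \<le> \<bar>k - b\<bar>"
proof -
  have "(K t k - b)\<^sup>2 \<le> (K 0 k - b)\<^sup>2"
  proof (rule antimono_if_deriv_nonpos[OF _ _ t])
    show "\<forall>t\<ge>0. ((\<lambda>t. (K t k - b)\<^sup>2) has_real_derivative 2 * ((K t k - b) * F (K t k)))
        (at t within {0..})"
      using solves[OF k] by (auto intro!: derivative_eq_intros simp: power2_eq_square)
    show "\<forall>t\<ge>0. 2 * ((K t k - b) * F (K t k)) \<le> 0"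
      using inward[OF stays[OF k]] by (simp add: mult.commute)
  qed
  then show ?thesis by (simp add: start[OF k] abs_le_square_iff)
qed

lemma constant_trajectory:
  assumes "0 \<le> t"
  shows "K t b = b"
  using distance_nonincreasing[OF point_in assms] by simp

lemma rest_point:
  shows "F b = 0"
proof -
  have der: "((\<lambda>t. K t b) has_real_derivative F b) (at 1)"
    using has_real_derivative_atLeast_interior[OF solves[OF point_in, of 1]] constant_trajectory[of 1] by simp
  have "((\<lambda>t. b) has_real_derivative F b) (at 1)"
    using der
    by (rule has_field_derivative_transform_within_open[where S = "{0<..}"])
      (auto simp: constant_trajectory)
  then show ?thesis
    using DERIV_unique[OF _ DERIV_const] by blast
qed

lemma rate_nonpos:
  assumes "(F has_real_derivative D) (at b)"
  shows "D \<le> 0"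
proof (rule tendsto_upperbound)
  show "((\<lambda>k. (F k - F b) / (k - b)) \<longlongrightarrow> D) (at b)"
    using assms by (simp add: has_field_derivative_iff)
  have "\<forall>\<^sub>F k in at b. k \<in> \<Omega> \<and> k \<noteq> b"
    using open_domain point_in by (auto simp: eventually_at_topological)
  then show "\<forall>\<^sub>F k in at b. (F k - F b) / (k - b) \<le> 0"
  proof eventually_elim
    case (elim k)
    then show ?case
      using inward[of k] by (auto simp: rest_point divide_le_0_iff mult_le_0_iff)
  qed
qed simp

text \<open>The distance to \<open>b\<close> does not increase, so a property that holds near \<open>b\<close> holds along the whole of
  any trajectory that starts close enough.\<close>

lemma trajectory_near:
  assumes "\<forall>\<^sub>F k in nhds b. Q k"
  obtains k where "k \<in> \<Omega>" "k \<noteq> b" "\<And>t. 0 \<le> t \<Longrightarrow> Q (K t k)"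
proof -
  have "\<forall>\<^sub>F k in nhds b. Q k \<and> k \<in> \<Omega>"
    using assms open_domain point_in by (simp add: eventually_conj eventually_nhds_in_open)
  then obtain d where d: "d > 0" "\<And>k. dist k b < d \<Longrightarrow> Q k \<and> k \<in> \<Omega>"
    by (auto simp: eventually_nhds_metric)
  let ?k = "b + d / 2"
  have k: "?k \<in> \<Omega>" using d by (auto simp: dist_real_def)
  show ?thesis
  proof (rule that[OF k])
    show "Q (K t ?k)" if "0 \<le> t" for t
      using distance_nonincreasing[OF k that] d by (auto simp: dist_real_def)
  qed (use d in auto)
qed

text \<open>Here the value \<open>V k\<close> is the discounted payoff along the trajectory from \<open>k\<close>. Its difference
  quotient at \<open>b\<close> is the discounted integral of \<open>(g (K t k) - g b) / (k - b)\<close>, which is about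
  \<open>p * m\<close> times the relative displacement \<open>z t = (K t k - b) / (k - b)\<close>.\<close>

lemma response_of_value:
  assumes F: "(F has_real_derivative - a) (at b)"
    and g: "(g has_real_derivative p * m) (at b)"
    and V: "(V has_real_derivative p) (at b)"
    and payoff: "\<And>k. k \<in> \<Omega> \<Longrightarrow> ((\<lambda>t. h t * g (K t k)) has_integral V k) {0..}"
    and e: "0 < (e::real)"
  shows "\<exists>z D q P. z 0 = 1 \<and>
      (\<forall>t\<ge>0. (z has_real_derivative D t) (at t within {0..})) \<and>
      (\<forall>t\<ge>0. \<bar>D t + a * z t\<bar> \<le> e * \<bar>z t\<bar>) \<and>
      (\<forall>t\<ge>0. \<bar>q t - p * m * z t\<bar> \<le> e * \<bar>z t\<bar>) \<and>
      ((\<lambda>t. h t * q t) has_integral P) {0..} \<and> \<bar>P - p\<bar> \<le> e"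
proof -
  obtain k where k: "k \<in> \<Omega>" "k \<noteq> b"
    and close: "\<And>t. 0 \<le> t \<Longrightarrow> \<bar>F (K t k) - F b - - a * (K t k - b)\<bar> \<le> e * \<bar>K t k - b\<bar> \<and>
      \<bar>g (K t k) - g b - p * m * (K t k - b)\<bar> \<le> e * \<bar>K t k - b\<bar> \<and>
      \<bar>V (K t k) - V b - p * (K t k - b)\<bar> \<le> e * \<bar>K t k - b\<bar>"
    using trajectory_near[OF eventually_conj[OF eventually_linear_approx[OF F e]
          eventually_conj[OF eventually_linear_approx[OF g e] eventually_linear_approx[OF V e]]]]
    by metis
  define y where "y = k - b"
  have y: "y \<noteq> 0" using k by (simp add: y_def)
  have scale: "\<bar>A / y - r * (B / y)\<bar> \<le> e * \<bar>B / y\<bar>" if "\<bar>A - r * B\<bar> \<le> e * \<bar>B\<bar>" for A B r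
  proof -
    have "\<bar>A / y - r * (B / y)\<bar> = \<bar>A - r * B\<bar> / \<bar>y\<bar>"
      by (simp add: diff_divide_distrib flip: abs_divide)
    also have "\<dots> \<le> e * \<bar>B\<bar> / \<bar>y\<bar>" using that by (intro divide_right_mono) auto
    finally show ?thesis by simp
  qed
  show ?thesis
  proof (intro exI conjI allI impI)
    show "(K 0 k - b) / y = 1" using y by (simp add: start[OF k(1)] y_def)
    show "((\<lambda>t. (K t k - b) / y) has_real_derivative F (K t k) / y) (at t within {0..})"
      if "0 \<le> t" for t
      using solves[OF k(1) that] y by (auto intro!: derivative_eq_intros)
    show "\<bar>F (K t k) / y + a * ((K t k - b) / y)\<bar> \<le> e * \<bar>(K t k - b) / y\<bar>" if "0 \<le> t" for t
      using scale[of "F (K t k)" "- a" "K t k - b"] close[OF that] by (simp add: rest_point)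
    show "\<bar>(g (K t k) - g b) / y - p * m * ((K t k - b) / y)\<bar> \<le> e * \<bar>(K t k - b) / y\<bar>"
      if "0 \<le> t" for t
      using scale[of "g (K t k) - g b" "p * m" "K t k - b"] close[OF that] by simp
    have "((\<lambda>t. h t * g b) has_integral V b) {0..}"
      using payoff[OF point_in] by (rule has_integral_eq[rotated]) (simp add: constant_trajectory)
    then have "((\<lambda>t. (h t * g (K t k) - h t * g b) / y) has_integral (V k - V b) / y) {0..}"
      by (intro has_integral_divide has_integral_diff payoff k)
    then show "((\<lambda>t. h t * ((g (K t k) - g b) / y)) has_integral (V k - V b) / y) {0..}"
      by (simp add: right_diff_distrib)
    show "\<bar>(V k - V b) / y - p\<bar> \<le> e"
      using scale[of "V k - V b" p y] close[of 0] y by (simp add: start[OF k(1)] y_def)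
  qed
qed

text \<open>Here the marginal value \<open>v\<close> and the payoff \<open>g\<close> satisfy the differentiated equation. Integration by parts
  replaces \<open>h'\<close> times the payoff by \<open>h\<close> times the time derivative \<open>g' (K t k) * F (K t k)\<close> of the
  payoff, and the boundary term at time \<open>0\<close> cancels the summand \<open>g k\<close> of the equation. Dividing by the initial velocity \<open>F k\<close> expresses
  \<open>v k\<close> as a discounted integral with the relative velocity \<open>z t = F (K t k) / F k\<close> as weight.
  Division by the displacement \<open>k - b\<close> would lose all information when \<open>a = 0\<close>.\<close>

lemma response_of_velocity:
  assumes F: "\<And>k. k \<in> \<Omega> \<Longrightarrow> (F has_real_derivative F' k) (at k)" and F': "continuous_on \<Omega> F'"
    and moving: "\<And>k. k \<in> \<Omega> \<Longrightarrow> k \<noteq> b \<Longrightarrow> F k \<noteq> 0"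
    and g: "\<And>k. k \<in> \<Omega> \<Longrightarrow> (g has_real_derivative g' k) (at k)" and g': "continuous_on \<Omega> g'"
    and v: "continuous_on \<Omega> v"
    and h: "discount_function h h'" "\<And>t. 0 \<le> t \<Longrightarrow> h t \<le> exp (- r * t)"
    and eqn: "\<And>k. k \<in> \<Omega> \<Longrightarrow> \<exists>J. ((\<lambda>t. h' t * g (K t k)) has_integral J) {0..} \<and> v k * F k + J + g k = 0"
    and e: "0 < e" "e < r" and rate: "F' b = - a" "0 \<le> a" and gb: "g' b = v b * m"
  shows "\<exists>z D q P. z 0 = 1 \<and>
      (\<forall>t\<ge>0. (z has_real_derivative D t) (at t within {0..})) \<and>
      (\<forall>t\<ge>0. \<bar>D t + a * z t\<bar> \<le> e * \<bar>z t\<bar>) \<and>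
      (\<forall>t\<ge>0. \<bar>q t - v b * m * z t\<bar> \<le> e * \<bar>z t\<bar>) \<and>
      ((\<lambda>t. h t * q t) has_integral P) {0..} \<and> \<bar>P - v b\<bar> \<le> e"
proof -
  have h_der: "\<forall>t\<ge>0. (h has_real_derivative h' t) (at t within {0..})"
    and h': "\<forall>t\<ge>0. h' t \<le> 0" and h_nonneg: "\<forall>t\<ge>0. 0 \<le> h t" and h_lim: "(h \<longlongrightarrow> 0) at_top"
    and h0: "h 0 = 1"
    using h(1) by (auto simp: discount_function_def C1_on_def)
  have "continuous_on \<Omega> g"
    using g by (meson DERIV_isCont continuous_at_imp_continuous_on)
  note near = eventually_close[OF _ open_domain point_in e(1)]
  obtain k where k: "k \<in> \<Omega>" "k \<noteq> b"
    and close: "\<And>t. 0 \<le> t \<Longrightarrow> \<bar>F' (K t k) - F' b\<bar> \<le> e \<and> \<bar>g' (K t k) - g' b\<bar> \<le> e \<and>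
      \<bar>v (K t k) - v b\<bar> \<le> e \<and> \<bar>g (K t k) - g b\<bar> \<le> e"
    using trajectory_near[OF eventually_conj[OF near[OF F'] eventually_conj[OF near[OF g']
            eventually_conj[OF near[OF v] near[OF \<open>continuous_on \<Omega> g\<close>]]]]]
    by metis
  have w: "F k \<noteq> 0" using moving k by blast
  define z where "z = (\<lambda>t. F (K t k) / F k)"
  define D where "D = (\<lambda>t. F' (K t k) * z t)"
  have along: "((\<lambda>t. \<phi> (K t k)) has_real_derivative \<phi>' (K t k) * F (K t k)) (at t within {0..})"
    if "\<And>k. k \<in> \<Omega> \<Longrightarrow> (\<phi> has_real_derivative \<phi>' k) (at k)" "0 \<le> t" for \<phi> \<phi>' t
    using DERIV_chain2[OF that(1)[OF stays[OF k(1) that(2)]] solves[OF k(1) that(2)]] .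
  have z0: "z 0 = 1" using w by (simp add: z_def start[OF k(1)])
  have z_der: "\<forall>t\<ge>0. (z has_real_derivative D t) (at t within {0..})"
    unfolding z_def D_def using DERIV_cdivide[OF along[of F F', OF F], of _ "F k"] by simp
  have D: "\<forall>t\<ge>0. \<bar>D t + a * z t\<bar> \<le> e * \<bar>z t\<bar>"
  proof (intro allI impI)
    fix t :: real assume "0 \<le> t"
    have "D t + a * z t = (F' (K t k) - F' b) * z t"
      by (simp add: D_def rate algebra_simps)
    then show "\<bar>D t + a * z t\<bar> \<le> e * \<bar>z t\<bar>"
      using close[OF \<open>0 \<le> t\<close>] by (simp add: abs_mult mult_right_mono)
  qed
  have z_bounds: "0 \<le> z t" "z t \<le> exp (- (a - e) * t)" if "0 \<le> t" for t
    using near_exponential_decay[OF z0 z_der D that] by (auto intro: order_trans[OF exp_ge_zero])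
  define q where "q = (\<lambda>t. g' (K t k) * z t)"
  have q: "\<bar>q t - v b * m * z t\<bar> \<le> e * \<bar>z t\<bar>" if "0 \<le> t" for t
  proof -
    have "q t - v b * m * z t = (g' (K t k) - g' b) * z t"
      by (simp add: q_def gb algebra_simps)
    then show ?thesis using close[OF that] by (simp add: abs_mult mult_right_mono)
  qed
  obtain J where J: "((\<lambda>t. h' t * g (K t k)) has_integral J) {0..}" "v k * F k + J + g k = 0"
    using eqn[OF k(1)] by blast
  let ?G' = "\<lambda>t. h' t * g (K t k) + h t * (g' (K t k) * F (K t k))"
  have "(?G' has_integral 0 - h 0 * g (K 0 k)) {0..}"
  proof (rule has_integral_derivative_atLeast)
    show "\<forall>t\<ge>0. ((\<lambda>t. h t * g (K t k)) has_real_derivative ?G' t) (at t within {0..})"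
      using DERIV_mult[OF h_der[rule_format] along[of g g', OF g]]
      by (simp add: algebra_simps)
    define M where "M = \<bar>g b\<bar> + e"
    define N where "N = (\<bar>g' b\<bar> + e) * \<bar>F k\<bar>"
    show "\<bar>?G' t\<bar> \<le> - (h' t) * M + exp (- (r + (a - e)) * t) * N" if t: "0 \<le> t" for t
    proof -
      have "\<bar>h' t * g (K t k)\<bar> \<le> - h' t * M"
        unfolding abs_mult M_def using close[OF t] h' t by (intro mult_mono) auto
      moreover have "\<bar>h t * (g' (K t k) * F (K t k))\<bar> \<le> exp (- (r + (a - e)) * t) * N"
      proof -
        have "h t * z t \<le> exp (- r * t) * exp (- (a - e) * t)"
          using h(2)[OF t] z_bounds[OF t] h_nonneg t by (intro mult_mono) auto
        also have "\<dots> = exp (- (r + (a - e)) * t)"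
          using exp_decay_mult[of r t "a - e"] by (simp only:)
        finally have hz: "h t * z t \<le> exp (- (r + (a - e)) * t)" .
        have g'_bound: "\<bar>g' (K t k)\<bar> * \<bar>F k\<bar> \<le> N"
          unfolding N_def using close[OF t] by (intro mult_right_mono) auto
        have "h t * (g' (K t k) * F (K t k)) = (h t * z t) * (g' (K t k) * F k)"
          using w by (simp add: z_def)
        then have "\<bar>h t * (g' (K t k) * F (K t k))\<bar> = (h t * z t) * (\<bar>g' (K t k)\<bar> * \<bar>F k\<bar>)"
          using h_nonneg z_bounds[OF t] t
          by (simp only: abs_mult[of "h t * z t"] abs_mult[of "g' (K t k)"]) simp
        also have "\<dots> \<le> exp (- (r + (a - e)) * t) * N"
          using hz g'_bound by (intro mult_mono) auto
        finally show ?thesis .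
      qed
      ultimately show ?thesis by linarith
    qed
    show "(\<lambda>t. - (h' t) * M + exp (- (r + (a - e)) * t) * N) integrable_on {0..}"
    proof (intro integrable_add integrable_on_mult_left integrable_neg)
      show "h' integrable_on {0..}" using discount_derivative_integrable[OF h(1)] .
      show "(\<lambda>t. exp (- (r + (a - e)) * t)) integrable_on {0..}"
        using has_integral_exp_decay[of "r + (a - e)"] e rate(2) by auto
    qed
    have "((\<lambda>t. g (K t k)) \<longlongrightarrow> g b) at_top"
      using isCont_tendsto_compose[OF DERIV_isCont[OF g[OF point_in]] converges[OF k(1)]] .
    from tendsto_mult[OF h_lim this] show "((\<lambda>t. h t * g (K t k)) \<longlongrightarrow> 0) at_top" by simp
  qed
  then have "((\<lambda>t. ?G' t - h' t * g (K t k)) has_integral - g k - J) {0..}"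
    using J(1) by (intro has_integral_diff) (auto simp: h0 start[OF k(1)])
  then have "((\<lambda>t. (h t * (g' (K t k) * F (K t k))) / F k) has_integral (- g k - J) / F k) {0..}"
    by (intro has_integral_divide) simp
  moreover have "(- g k - J) / F k = v k" using J(2) w by (simp add: field_simps)
  ultimately have P: "((\<lambda>t. h t * q t) has_integral v k) {0..}"
    by (simp add: q_def z_def)
  have "\<bar>v k - v b\<bar> \<le> e" using close[of 0] by (simp add: start[OF k(1)])
  with z0 z_der D q P show ?thesis by blast
qed

end

theorem corollary12:
  fixes C :: "real set" and u u' i f f' h h' :: "real \<Rightarrow> real" and \<rho>\<^sub>1 \<rho>\<^sub>2 kbar :: real
  assumes "discount_function h h'"
    and "utility_function C u u' i"
    and no_satiation: "\<forall>c\<in>C. u' c \<noteq> 0"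
    and "production_function f f'"
    and "0 < \<rho>\<^sub>1" and "\<rho>\<^sub>1 \<le> \<rho>\<^sub>2"
    and "\<forall>t\<ge>0. exp (- \<rho>\<^sub>2 * t) \<le> h t \<and> h t \<le> exp (- \<rho>\<^sub>1 * t)"
    and "equilibrium_point C u u' i f h h' kbar"
  shows "\<rho>\<^sub>1 \<le> f' kbar \<and> f' kbar \<le> \<rho>\<^sub>2"
proof -
  obtain \<Omega> \<sigma> where eq: "stationary_equilibrium_strategy C u u' i f h h' \<Omega> \<sigma>" and "kbar \<in> \<Omega>"
    and attract: "\<And>k x. k \<in> \<Omega> \<Longrightarrow> trajectory f \<Omega> \<sigma> k x \<Longrightarrow> (x \<longlongrightarrow> kbar) at_top"
    using assms(8) unfolding equilibrium_point_def by blast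
  obtain V V' K where "open \<Omega>" and \<Omega>: "\<Omega> \<subseteq> {0<..}" and V: "C2_on \<Omega> V V'"
    and \<sigma>_all: "\<forall>k\<in>\<Omega>. V' k \<in> u' ` C \<and> \<sigma> k = i (V' k)"
    and K_all: "\<forall>k\<in>\<Omega>. trajectory f \<Omega> \<sigma> k (\<lambda>t. K t k)"
    and equation: "(\<forall>k\<in>\<Omega>. ((\<lambda>t. h t * u (i (V' (K t k)))) has_integral V k) {0..}) \<or>
      (\<forall>k\<in>\<Omega>. \<exists>J. ((\<lambda>t. h' t * u (i (V' (K t k)))) has_integral J) {0..} \<and>
        V' k * f k + J + u_tilde C u (V' k) = 0)"
    using eq unfolding stationary_equilibrium_strategy_def
    by (elim conjE exE) (rule that; assumption)
  note \<sigma> = bspec[OF \<sigma>_all] and K = bspec[OF K_all]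
  have at: "at k within \<Omega> = at k" if "k \<in> \<Omega>" for k
    using \<open>open \<Omega>\<close> that by (rule at_within_open[rotated])
  obtain V'' where "\<forall>k\<in>\<Omega>. (V has_real_derivative V' k) (at k within \<Omega>)"
    and "\<forall>k\<in>\<Omega>. (V' has_real_derivative V'' k) (at k within \<Omega>)"
    and V''_cont: "continuous_on \<Omega> V''" and V'_cont: "continuous_on \<Omega> V'"
    using V unfolding C2_on_def C1_on_def by (elim exE conjE) (rule that; assumption)
  then have V_der: "\<And>k. k \<in> \<Omega> \<Longrightarrow> (V has_real_derivative V' k) (at k)"
    and V'_der: "\<And>k. k \<in> \<Omega> \<Longrightarrow> (V' has_real_derivative V'' k) (at k)"
    using at by simp_all
  obtain i' where "open C" and u_der: "\<forall>c\<in>C. (u has_real_derivative u' c) (at c within C)"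
    and inv: "\<forall>c\<in>C. \<forall>x\<in>u' ` C. u' c = x \<longleftrightarrow> c = i x"
    and i_der: "\<forall>x\<in>u' ` C. (i has_real_derivative i' x) (at x within u' ` C)"
    and i'_cont: "continuous_on (u' ` C) i'"
    using assms(2) unfolding utility_function_def C2_on_def C1_on_def
    by (elim exE conjE) (rule that; assumption)
  have \<sigma>_C: "\<sigma> k \<in> C" "u' (\<sigma> k) = V' k" if k: "k \<in> \<Omega>" for k
  proof -
    obtain c where c: "c \<in> C" "V' k = u' c" using \<sigma>[OF k] by blast
    then have "c = i (V' k)" using inv by auto
    then have "\<sigma> k = c" using \<sigma>[OF k] by simp
    then show "\<sigma> k \<in> C" "u' (\<sigma> k) = V' k" using c by simp_all
  qed
  have f_der: "\<forall>k\<in>{0<..}. (f has_real_derivative f' k) (at k within {0<..})"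
    and f'_cont: "continuous_on {0<..} f'"
    using assms(4) unfolding production_function_def C2_on_def C1_on_def by blast+
  define s where "s = (\<lambda>k. i' (V' k) * V'' k)"
  have \<sigma>_der: "(\<sigma> has_real_derivative s k) (at k)" if k: "k \<in> \<Omega>" for k
  proof -
    have "(i \<circ> V' has_real_derivative i' (V' k) * V'' k) (at k within \<Omega>)"
      using \<sigma> k V'_der
      by (intro DERIV_image_chain DERIV_subset[OF bspec[OF i_der]]) (auto simp: at)
    then have "(i \<circ> V' has_real_derivative s k) (at k)"
      by (simp add: s_def at[OF k])
    then show ?thesis
      by (rule has_field_derivative_transform_within_open[OF _ \<open>open \<Omega>\<close> k]) (simp add: \<sigma>)
  qed
  have s_cont: "continuous_on \<Omega> s"
    unfolding s_def using \<sigma>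
    by (intro continuous_intros V''_cont continuous_on_compose2[OF i'_cont V'_cont]) auto
  define F where "F = (\<lambda>k. f k - \<sigma> k)"
  define F' where "F' = (\<lambda>k. f' k - s k)"
  have F_der: "(F has_real_derivative F' k) (at k)" if k: "k \<in> \<Omega>" for k
  proof -
    have "0 < k" using k \<Omega> by auto
    then have "(f has_real_derivative f' k) (at k)"
      using bspec[OF f_der, of k] at_within_open[of k "{0<..}"] by simp
    then show ?thesis unfolding F_def F'_def by (intro DERIV_diff \<sigma>_der k)
  qed
  have F'_cont: "continuous_on \<Omega> F'"
    unfolding F'_def by (intro continuous_intros s_cont continuous_on_subset[OF f'_cont \<Omega>])
  define g where "g = (\<lambda>k. u (i (V' k)))"
  have g_der: "(g has_real_derivative V' k * s k) (at k)" if k: "k \<in> \<Omega>" for k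
  proof -
    have "(u has_real_derivative V' k) (at (\<sigma> k))"
      using bspec[OF u_der \<sigma>_C(1)[OF k]] \<sigma>_C[OF k] at_within_open[OF _ \<open>open C\<close>] by simp
    from DERIV_chain2[OF this \<sigma>_der[OF k]]
    show ?thesis
      by (rule has_field_derivative_transform_within_open[OF _ \<open>open \<Omega>\<close> k]) (simp add: \<sigma> g_def)
  qed
  interpret attracting_point \<Omega> F K kbar
  proof
    show "open \<Omega>" "kbar \<in> \<Omega>" by fact+
    fix k assume k: "k \<in> \<Omega>"
    show "K 0 k = k"
      using K[OF k] by (simp add: trajectory_def)
    show "K t k \<in> \<Omega>" "((\<lambda>t. K t k) has_real_derivative F (K t k)) (at t within {0..})"
      if "0 \<le> t" for t
      using K[OF k] that by (simp_all add: trajectory_def F_def)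
    show "((\<lambda>t. K t k) \<longlongrightarrow> kbar) at_top"
      using attract[OF k K[OF k]] .
  qed
  \<comment> \<open>A second rest point would carry a constant trajectory that does not converge to \<open>kbar\<close>.\<close>
  have moving: "F k \<noteq> 0" if "k \<in> \<Omega>" "k \<noteq> kbar" for k
  proof
    assume "F k = 0"
    then have "trajectory f \<Omega> \<sigma> k (\<lambda>_. k)"
      using that by (simp add: trajectory_def F_def)
    then have "((\<lambda>_. k) \<longlongrightarrow> kbar) (at_top :: real filter)"
      using attract that by blast
    then show False using that by (simp add: tendsto_const_iff)
  qed
  define a where "a = - F' kbar"
  have a: "0 \<le> a" using rate_nonpos[OF F_der[OF point_in]] by (simp add: a_def)
  have p: "V' kbar \<noteq> 0"
    using \<sigma>_C[OF point_in] no_satiation by auto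
  have "\<forall>t\<ge>0. (h has_real_derivative h' t) (at t within {0..})"
    using assms(1) by (simp add: discount_function_def C1_on_def)
  then have h_cont: "continuous_on {0..} h"
    by (rule deriv_within_imp_continuous_on)
  note rate = rate_from_responses[OF p assms(5,6) a h_cont assms(7)]
  have "\<rho>\<^sub>1 + a \<le> s kbar \<and> s kbar \<le> \<rho>\<^sub>2 + a"
    using equation
  proof
    assume "\<forall>k\<in>\<Omega>. ((\<lambda>t. h t * u (i (V' (K t k)))) has_integral V k) {0..}"
    then have payoff: "((\<lambda>t. h t * g (K t k)) has_integral V k) {0..}" if "k \<in> \<Omega>" for k
      using that by (simp add: g_def)
    have "(F has_real_derivative - a) (at kbar)"
      using F_der[OF point_in] by (simp add: a_def)
    note response = response_of_value[OF this g_der[OF point_in] V_der[OF point_in] payoff]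
    show ?thesis
      by (rule rate) (rule response, assumption+)
  next
    assume eqn: "\<forall>k\<in>\<Omega>. \<exists>J. ((\<lambda>t. h' t * u (i (V' (K t k)))) has_integral J) {0..} \<and>
        V' k * f k + J + u_tilde C u (V' k) = 0"
    have velocity_eqn: "\<exists>J. ((\<lambda>t. h' t * g (K t k)) has_integral J) {0..} \<and> V' k * F k + J + g k = 0"
      if k: "k \<in> \<Omega>" for k
    proof -
      obtain J where J: "((\<lambda>t. h' t * u (i (V' (K t k)))) has_integral J) {0..}"
        "V' k * f k + J + u_tilde C u (V' k) = 0"
        using bspec[OF eqn k] by blast
      have "u_tilde C u (V' k) = g k - V' k * \<sigma> k"
        using u_tilde_eq[OF assms(2), of "V' k"] \<sigma>[OF k] by (simp add: g_def)
      then have "V' k * F k + J + g k = 0"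
        using J(2) by (simp add: F_def right_diff_distrib)
      then show ?thesis using J(1) unfolding g_def by blast
    qed
    have payoff_deriv_cont: "continuous_on \<Omega> (\<lambda>k. V' k * s k)"
      by (intro continuous_intros V'_cont s_cont)
    have "h t \<le> exp (- \<rho>\<^sub>1 * t)" if "0 \<le> t" for t
      using assms(7) that by simp
    note response = response_of_velocity[OF F_der F'_cont moving g_der payoff_deriv_cont V'_cont
        assms(1) this velocity_eqn _ _ _ a refl]
    show ?thesis
      by (rule rate) (rule response, assumption+, simp add: a_def)
  qed
  then show ?thesis by (simp add: a_def F'_def)
qed

end
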